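(* Let $n\ge 2$, let $m,\alpha_1,\dots,\alpha_n$ be positive integers, and let $T_{\alpha,m}$ be the operator $$T_{\alpha,m}f(x)=\int_{\mathbb{R}^n}e^{i(x_1^{\alpha_1}y_1^m+\cdots+x_n^{\alpha_n}y_n^m)}f(y)\,dy .$$ Let $p\ge 1$ and suppose there is a constant $A$ such that $$\left(\int_{\mathbb{S}^{n-1}}|T_{\alpha,m}f|^2\,d\sigma\right)^{1/2}\le A\,\|f\|_{L^p(\mathbb{R}^n)}$$ for all Schwartz functions $f$ (equivalently, for the class of bounded compactly supported functions for which both sides make sense). Set $S=\min_{1\le i\le n}\sum_{j\ne i}\alpha_j$ and assume $2(2+S)>(n-1)m$. Then $$1\le p\le \frac{2(2+S)}{2(2+S)-(n-1)m}.$$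
   Context: $\mathbb{S}^{n-1}$ is the unit sphere in $\mathbb{R}^n$ with surface measure $d\sigma$. *)

theory Defs
  imports "HOL-Analysis.Analysis"
begin

definition partial_deriv :: "'n::finite \<Rightarrow> (real^'n \<Rightarrow> complex) \<Rightarrow> real^'n \<Rightarrow> complex" where
  "partial_deriv i g x = vector_derivative (\<lambda>t. g (x + t *\<^sub>R axis i 1)) (at 0)"

fun iter_partial :: "'n::finite list \<Rightarrow> (real^'n \<Rightarrow> complex) \<Rightarrow> real^'n \<Rightarrow> complex" where
  "iter_partial [] g = g"
| "iter_partial (i # is) g = partial_deriv i (iter_partial is g)"

definition schwartz :: "(real^'n::finite \<Rightarrow> complex) \<Rightarrow> bool" where
  "schwartz f \<longleftrightarrow>
     (\<forall>is x. iter_partial is f differentiable (at x)) \<and>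
     (\<forall>(k::nat) is. bounded (range (\<lambda>x. ((1 + norm x) ^ k) *\<^sub>R iter_partial is f x)))"

definition T_op :: "('n::finite \<Rightarrow> nat) \<Rightarrow> nat \<Rightarrow> (real^'n \<Rightarrow> complex) \<Rightarrow> real^'n \<Rightarrow> complex" where
  "T_op \<alpha> m f x =
     integral\<^sup>L lborel (\<lambda>y. exp (\<i> * complex_of_real (\<Sum>i\<in>UNIV. (x$i) ^ \<alpha> i * (y$i) ^ m)) * f y)"

definition Lp_norm :: "real \<Rightarrow> (real^'n::finite \<Rightarrow> complex) \<Rightarrow> real" where
  "Lp_norm p f = (integral\<^sup>L lborel (\<lambda>y. cmod (f y) powr p)) powr (1 / p)"

text \<open>Integral over the unit sphere S^{n-1} w.r.t. surface measure, via the standard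
  cone-measure identity sigma(E) = n * lambda({t x : x in E, 0 < t <= 1}).\<close>
definition sphere_integral :: "(real^'n::finite \<Rightarrow> real) \<Rightarrow> real" where
  "sphere_integral g =
     real CARD('n) * integral\<^sup>L lborel (\<lambda>x. indicator (ball 0 1 - {0}) x * g (x /\<^sub>R norm x))"

end

theory Submission
  imports Defs "HOL-Probability.Distributions"
begin

text \<open>
  A Knapp-type example. Let \<open>k\<close> attain the minimum \<open>S\<close>, and test the inequality on the Gaussian
  \<open>exp (- \<Sum>\<^sub>j (y\<^sub>j / R\<^sub>j)\<^sup>2)\<close> modulated by \<open>exp (- i y\<^sub>k^m)\<close>, where \<open>R\<^sub>k = c s\<^sup>2\<close> and
  \<open>R\<^sub>j = c s^\<alpha>\<^sub>j\<close> for \<open>j \<noteq> k\<close>. On the cap \<open>\<bar>x\<^sub>j\<bar> \<le> s^-m\<close> (\<open>j \<noteq> k\<close>) around the pole \<open>e\<^sub>k\<close> one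
  has \<open>1 - x\<^sub>k = O(s^-2m)\<close>, so for small \<open>c\<close> the phase stays essentially constant on the bulk of the
  Gaussian and \<open>\<bar>T f\<bar>\<close> is comparable to \<open>\<Prod>\<^sub>j R\<^sub>j \<approx> s^(2+S)\<close>. As the cap has measure about
  \<open>s^(-m(n-1))\<close> and the \<open>L^p\<close> norm of \<open>f\<close> is about \<open>s^((2+S)/p)\<close>, letting \<open>s\<close> tend to infinity
  yields \<open>2 + S - m(n-1)/2 \<le> (2+S)/p\<close>.
\<close>

section \<open>Polynomials times exponentials as Schwartz functions\<close>

text \<open>
  Functions \<open>P exp \<phi>\<close> with \<open>P\<close>, \<open>\<phi>\<close> polynomial are closed under partial derivatives, which avoids
  cut-off functions when checking the Schwartz property.
\<close>

inductive complex_poly :: "(real^'n::finite \<Rightarrow> complex) \<Rightarrow> bool" where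
  const: "complex_poly (\<lambda>x. c)"
| coord: "complex_poly (\<lambda>x. complex_of_real (x $ i))"
| add: "complex_poly P \<Longrightarrow> complex_poly Q \<Longrightarrow> complex_poly (\<lambda>x. P x + Q x)"
| mult: "complex_poly P \<Longrightarrow> complex_poly Q \<Longrightarrow> complex_poly (\<lambda>x. P x * Q x)"

lemma complex_poly_power: "complex_poly P \<Longrightarrow> complex_poly (\<lambda>x. P x ^ k)"
  by (induction k) (auto intro: complex_poly.intros)

lemma complex_poly_sum:
  "finite I \<Longrightarrow> (\<And>i. i \<in> I \<Longrightarrow> complex_poly (P i)) \<Longrightarrow> complex_poly (\<lambda>x. \<Sum>i\<in>I. P i x)"
  by (induction I rule: finite_induct) (auto intro: complex_poly.intros)

lemma complex_poly_differentiable: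
  fixes P :: "real^'n::finite \<Rightarrow> complex"
  assumes "complex_poly P"
  shows "P differentiable (at x)"
  using assms
proof induction
  case (coord i)
  have "((\<lambda>x::real^'n. complex_of_real (x $ i)) has_derivative (\<lambda>x. complex_of_real (x $ i))) (at x)"
    by (intro bounded_linear_imp_has_derivative bounded_linear_compose[OF bounded_linear_of_real]
        bounded_linear_vec_nth)
  then show ?case
    by (auto simp: differentiable_def)
qed auto

text \<open>Formulated along the line \<open>x + t *\<^sub>R axis i 1\<close> because
  \<open>partial_deriv\<close> is a vector derivative in \<open>t\<close> at 0.\<close>

lemma complex_poly_partial:
  fixes P :: "real^'n::finite \<Rightarrow> complex"
  assumes "complex_poly P"
  shows "\<exists>Q. complex_poly Q \<and>
    (\<forall>x. ((\<lambda>t. P (x + t *\<^sub>R axis i 1)) has_vector_derivative Q x) (at 0))"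
  using assms
proof induction
  case (const c)
  show ?case
    by (intro exI[of _ "\<lambda>x. 0"]) (auto intro: complex_poly.intros)
next
  case (coord j)
  have "((\<lambda>t. complex_of_real ((x + t *\<^sub>R axis i 1) $ j)) has_vector_derivative
      of_real (axis i 1 $ j)) (at 0)" for x :: "real^'n"
    by (auto intro!: derivative_eq_intros has_vector_derivative_of_real
        simp: has_real_derivative_iff_has_vector_derivative[symmetric])
  then show ?case
    by (intro exI[of _ "\<lambda>x. of_real (axis i 1 $ j)"]) (auto intro: complex_poly.intros)
next
  case (add P Q)
  then obtain P' Q' where "complex_poly P'" "complex_poly Q'"
    and d: "((\<lambda>t. P (x + t *\<^sub>R axis i 1)) has_vector_derivative P' x) (at 0)"
      "((\<lambda>t. Q (x + t *\<^sub>R axis i 1)) has_vector_derivative Q' x) (at 0)" for x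
    by blast
  then show ?case
    by (intro exI[of _ "\<lambda>x. P' x + Q' x"])
      (auto intro: complex_poly.intros has_vector_derivative_add)
next
  case (mult P Q)
  then obtain P' Q' where "complex_poly P'" "complex_poly Q'"
    and d: "((\<lambda>t. P (x + t *\<^sub>R axis i 1)) has_vector_derivative P' x) (at 0)"
      "((\<lambda>t. Q (x + t *\<^sub>R axis i 1)) has_vector_derivative Q' x) (at 0)" for x
    by blast
  with mult.hyps show ?case
    by (intro exI[of _ "\<lambda>x. P x * Q' x + P' x * Q x"])
      (auto intro!: complex_poly.intros has_vector_derivative_mult[OF d, simplified])
qed

lemma complex_poly_growth:
  fixes P :: "real^'n::finite \<Rightarrow> complex"
  assumes "complex_poly P"
  shows "\<exists>C k. \<forall>x. norm (P x) \<le> C * (1 + norm x) ^ k"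
  using assms
proof induction
  case (const c)
  show ?case
    by (intro exI[of _ "norm c"] exI[of _ 0]) auto
next
  case (coord i)
  have "norm (complex_of_real (x $ i)) \<le> 1 * (1 + norm x) ^ 1" for x :: "real^'n"
    using component_le_norm_cart[of x i] by simp
  then show ?case by blast
next
  case (add P Q)
  then obtain C k D l where b: "norm (P x) \<le> C * (1 + norm x) ^ k"
      "norm (Q x) \<le> D * (1 + norm x) ^ l" for x
    by blast
  \<comment> \<open>The absolute values allow both exponents to be raised to \<open>k + l\<close>
    without knowing the signs of \<open>C\<close> and \<open>D\<close>.\<close>
  have "norm (P x + Q x) \<le> (\<bar>C\<bar> + \<bar>D\<bar>) * (1 + norm x) ^ (k + l)" for x
  proof -
    have "C * (1 + norm x) ^ k \<le> \<bar>C\<bar> * (1 + norm x) ^ (k + l)"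
      by (intro mult_mono power_increasing) auto
    moreover have "D * (1 + norm x) ^ l \<le> \<bar>D\<bar> * (1 + norm x) ^ (k + l)"
      by (intro mult_mono power_increasing) auto
    ultimately show ?thesis
      using b[of x] norm_triangle_ineq[of "P x" "Q x"] by (simp add: distrib_right)
  qed
  then show ?case by blast
next
  case (mult P Q)
  then obtain C k D l where b: "norm (P x) \<le> C * (1 + norm x) ^ k"
      "norm (Q x) \<le> D * (1 + norm x) ^ l" for x
    by blast
  have "norm (P x * Q x) \<le> (C * D) * (1 + norm x) ^ (k + l)" for x
  proof -
    have "norm (P x) * norm (Q x) \<le> (C * (1 + norm x) ^ k) * (D * (1 + norm x) ^ l)"
      using b[of x] by (intro mult_mono) (auto intro: order_trans[OF norm_ge_zero])
    then show ?thesis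
      by (simp add: norm_mult power_add mult_ac)
  qed
  then show ?case by blast
qed

text \<open>Since 1 + t \<le> exp t, the left side is at most exp (k t - a t^2); completing the
  square bounds the exponent.\<close>

lemma power_times_gaussian_bounded:
  fixes a t :: real
  assumes "a > 0" "t \<ge> 0"
  shows "(1 + t) ^ k * exp (- (a * t\<^sup>2)) \<le> exp ((real k)\<^sup>2 / (4 * a))"
proof -
  have "(1 + t) ^ k \<le> exp t ^ k"
    using assms by (intro power_mono) auto
  also have "\<dots> = exp (real k * t)"
    by (simp add: exp_of_nat_mult)
  finally have "(1 + t) ^ k * exp (- (a * t\<^sup>2)) \<le> exp (real k * t - a * t\<^sup>2)"
    by (simp add: exp_diff exp_minus field_simps)
  moreover have "real k * t - a * t\<^sup>2 \<le> (real k)\<^sup>2 / (4 * a)"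
  proof -
    have "0 \<le> (real k - 2 * a * t)\<^sup>2" by simp
    also have "\<dots> = (real k)\<^sup>2 - 4 * a * (real k * t - a * t\<^sup>2)"
      by (simp add: power2_eq_square algebra_simps)
    finally show ?thesis
      using assms by (simp add: field_simps)
  qed
  ultimately show ?thesis
    by (meson exp_le_cancel_iff order_trans)
qed

text \<open>The exponent \<phi> never changes: differentiating Q exp \<phi> only replaces Q by Q
  \<phi>' + Q', again a polynomial.\<close>

lemma iter_partial_poly_exp:
  assumes "complex_poly P" "complex_poly \<phi>"
  shows "\<exists>Q. complex_poly Q \<and> iter_partial is (\<lambda>x. P x * exp (\<phi> x)) = (\<lambda>x. Q x * exp (\<phi> x))"
proof (induction "is")
  case Nil
  then show ?case using assms by auto
next
  case (Cons i "is")
  then obtain Q where Q: "complex_poly Q"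
    and eq: "iter_partial is (\<lambda>x. P x * exp (\<phi> x)) = (\<lambda>x. Q x * exp (\<phi> x))"
    by blast
  obtain Q' where Q': "complex_poly Q'"
    and dQ: "((\<lambda>t. Q (x + t *\<^sub>R axis i 1)) has_vector_derivative Q' x) (at 0)" for x
    using complex_poly_partial[OF Q] by blast
  obtain \<phi>' where \<phi>': "complex_poly \<phi>'"
    and d\<phi>: "((\<lambda>t. \<phi> (x + t *\<^sub>R axis i 1)) has_vector_derivative \<phi>' x) (at 0)" for x
    using complex_poly_partial[OF assms(2)] by blast
  have "partial_deriv i (\<lambda>x. Q x * exp (\<phi> x)) x = (Q x * \<phi>' x + Q' x) * exp (\<phi> x)" for x
  proof -
    have "((\<lambda>t. exp (\<phi> (x + t *\<^sub>R axis i 1))) has_vector_derivative \<phi>' x * exp (\<phi> x)) (at 0)"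
      using field_vector_diff_chain_at[OF d\<phi>[of x], of exp "exp (\<phi> x)"]
      by (simp add: o_def)
    from has_vector_derivative_mult[OF dQ[of x] this] show ?thesis
      unfolding partial_deriv_def
      by (intro vector_derivative_at) (simp add: algebra_simps)
  qed
  moreover have "complex_poly (\<lambda>x. Q x * \<phi>' x + Q' x)"
    using Q Q' \<phi>' by (intro complex_poly.intros)
  ultimately show ?case
    using eq by (intro exI[of _ "\<lambda>x. Q x * \<phi>' x + Q' x"]) auto
qed

text \<open>Every iterated derivative is a polynomial times exp \<phi>, so its growth and the weight
  \<open>(1 + norm x) ^ k\<close> are both absorbed by the Gaussian decay of exp \<phi>.\<close>

lemma schwartz_poly_exp:
  fixes P \<phi> :: "real^'n::finite \<Rightarrow> complex"
  assumes P: "complex_poly P" and \<phi>: "complex_poly \<phi>"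
    and a: "a > 0" and Re: "\<And>x. Re (\<phi> x) \<le> - (a * (norm x)\<^sup>2)"
  shows "schwartz (\<lambda>x. P x * exp (\<phi> x))"
  unfolding schwartz_def
proof (intro conjI allI)
  fix "is" :: "'n list" and x
  obtain Q where Q: "complex_poly Q"
    and eq: "iter_partial is (\<lambda>x. P x * exp (\<phi> x)) = (\<lambda>x. Q x * exp (\<phi> x))"
    using iter_partial_poly_exp[OF P \<phi>] by blast
  obtain \<phi>' where "(\<phi> has_derivative \<phi>') (at x)"
    using complex_poly_differentiable[OF \<phi>] unfolding differentiable_def by blast
  then have "((\<lambda>x. exp (\<phi> x)) has_derivative (\<lambda>h. exp (\<phi> x) * \<phi>' h)) (at x)"
    using has_derivative_compose[of \<phi> \<phi>' x UNIV exp "\<lambda>h. exp (\<phi> x) * h"]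
    by (simp add: has_field_derivative_def[symmetric] DERIV_exp)
  then show "iter_partial is (\<lambda>x. P x * exp (\<phi> x)) differentiable (at x)"
    unfolding eq using complex_poly_differentiable[OF Q]
    by (intro differentiable_mult) (auto simp: differentiable_def)
next
  fix k :: nat and "is" :: "'n list"
  obtain Q where Q: "complex_poly Q"
    and eq: "iter_partial is (\<lambda>x. P x * exp (\<phi> x)) = (\<lambda>x. Q x * exp (\<phi> x))"
    using iter_partial_poly_exp[OF P \<phi>] by blast
  obtain C l where C: "norm (Q x) \<le> C * (1 + norm x) ^ l" for x
    using complex_poly_growth[OF Q] by blast
  have "norm ((1 + norm x) ^ k *\<^sub>R (Q x * exp (\<phi> x))) \<le> \<bar>C\<bar> * exp ((real (k + l))\<^sup>2 / (4 * a))" for x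
  proof -
    have "norm ((1 + norm x) ^ k *\<^sub>R (Q x * exp (\<phi> x)))
        = (1 + norm x) ^ k * (norm (Q x) * exp (Re (\<phi> x)))"
      by (simp add: norm_mult)
    moreover have "norm (Q x) \<le> \<bar>C\<bar> * (1 + norm x) ^ l"
      using C[of x] mult_right_mono[OF abs_ge_self, of "(1 + norm x) ^ l" C] by simp
    then have "(1 + norm x) ^ k * (norm (Q x) * exp (Re (\<phi> x))) \<le> (1 + norm x) ^ k * ((\<bar>C\<bar> * (1 + norm x) ^ l) * exp (- (a * (norm x)\<^sup>2)))"
      using Re[of x] by (intro mult_left_mono mult_mono) auto
    moreover have "(1 + norm x) ^ k * ((\<bar>C\<bar> * (1 + norm x) ^ l) * exp (- (a * (norm x)\<^sup>2)))
        = \<bar>C\<bar> * ((1 + norm x) ^ (k + l) * exp (- (a * (norm x)\<^sup>2)))"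
      by (simp add: power_add mult_ac)
    moreover have "\<bar>C\<bar> * ((1 + norm x) ^ (k + l) * exp (- (a * (norm x)\<^sup>2)))
        \<le> \<bar>C\<bar> * exp ((real (k + l))\<^sup>2 / (4 * a))"
      using a by (intro mult_left_mono power_times_gaussian_bounded) auto
    ultimately show ?thesis by linarith
  qed
  then show "bounded (range (\<lambda>x. (1 + norm x) ^ k *\<^sub>R iter_partial is (\<lambda>x. P x * exp (\<phi> x)) x))"
    unfolding eq bounded_iff by blast
qed

section \<open>Gaussian integrals and changes of scale\<close>

lemma integrable_gaussian:
  fixes a :: real
  assumes a: "a > 0"
  shows "integrable lborel (\<lambda>x::'a::euclidean_space. exp (- (a * (norm x)\<^sup>2)))"
proof (rule integrableI_bounded)
  show "(\<lambda>x::'a. exp (- (a * (norm x)\<^sup>2))) \<in> borel_measurable lborel"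
    by measurable
  have int1: "integrable lborel (\<lambda>t::real. exp (- (a * t\<^sup>2)))"
  proof -
    \<comment> \<open>The standard deviation for which the normal density is a multiple of exp (- a
      t^2).\<close>
    define s where "s = 1 / sqrt (2 * a)"
    have s: "s > 0" "2 * s\<^sup>2 = 1 / a" using a by (auto simp: s_def power_divide)
    have "(\<lambda>t::real. exp (- (a * t\<^sup>2))) = (\<lambda>t. sqrt (2 * pi * s\<^sup>2) * normal_density 0 s t)"
      using s a by (auto simp: normal_density_def fun_eq_iff)
    then show ?thesis
      using integrable_normal_density[OF s(1), of 0] by simp
  qed
  have "(\<integral>\<^sup>+x. norm (exp (- (a * (norm (x::'a))\<^sup>2))) \<partial>lborel)
      = (\<integral>\<^sup>+x. (\<Prod>b\<in>(Basis::'a set). ennreal (exp (- (a * (x \<bullet> b)\<^sup>2)))) \<partial>lborel)"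
  proof (rule nn_integral_cong)
    fix x :: 'a
    have "(norm x)\<^sup>2 = (\<Sum>b\<in>Basis. (x \<bullet> b)\<^sup>2)"
      unfolding power2_norm_eq_inner euclidean_inner[of x x] by (simp add: power2_eq_square)
    then show "ennreal (norm (exp (- (a * (norm x)\<^sup>2)))) = (\<Prod>b\<in>Basis. ennreal (exp (- (a * (x \<bullet> b)\<^sup>2))))"
      by (simp add: prod_ennreal exp_sum[symmetric] sum_negf sum_distrib_left)
  qed
  also have "\<dots> = (\<Prod>b\<in>(Basis::'a set). (\<integral>\<^sup>+t. ennreal (exp (- (a * t\<^sup>2))) \<partial>lborel))"
    by (rule nn_integral_lborel_prod) auto
  also have "\<dots> < \<infinity>"
    using int1 by (subst nn_integral_eq_integral) (auto simp: ennreal_power power_less_top_ennreal)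
  finally show "(\<integral>\<^sup>+x. norm (exp (- (a * (norm (x::'a))\<^sup>2))) \<partial>lborel) < \<infinity>" .
qed

text \<open>Half of the Gaussian exponent absorbs the power; the other half remains as an integrable
  majorant.\<close>

lemma integrable_power_gaussian:
  "integrable lborel (\<lambda>x::real^'n::finite. \<bar>x $ i\<bar> ^ k * exp (- (norm x)\<^sup>2))"
proof (rule Bochner_Integration.integrable_bound)
  show "integrable lborel (\<lambda>x::real^'n. exp ((real k)\<^sup>2 / 2) * exp (- ((1/2) * (norm x)\<^sup>2)))"
    by (intro integrable_mult_right integrable_gaussian) auto
  show "AE x::real^'n in lborel. norm (\<bar>x $ i\<bar> ^ k * exp (- (norm x)\<^sup>2)) \<le>
      norm (exp ((real k)\<^sup>2 / 2) * exp (- ((1/2) * (norm x)\<^sup>2)))"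
  proof (rule AE_I2)
    fix x :: "real^'n"
    have "\<bar>x $ i\<bar> ^ k * exp (- ((1/2) * (norm x)\<^sup>2)) \<le> (1 + norm x) ^ k * exp (- ((1/2) * (norm x)\<^sup>2))"
      using component_le_norm_cart[of x i] by (intro mult_right_mono power_mono) auto
    also have "\<dots> \<le> exp ((real k)\<^sup>2 / 2)"
      using power_times_gaussian_bounded[of "1/2" "norm x" k] by simp
    finally have "(\<bar>x $ i\<bar> ^ k * exp (- ((1/2) * (norm x)\<^sup>2))) * exp (- ((1/2) * (norm x)\<^sup>2))
        \<le> exp ((real k)\<^sup>2 / 2) * exp (- ((1/2) * (norm x)\<^sup>2))"
      by (intro mult_right_mono) auto
    then show "norm (\<bar>x $ i\<bar> ^ k * exp (- (norm x)\<^sup>2)) \<le>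
      norm (exp ((real k)\<^sup>2 / 2) * exp (- ((1/2) * (norm x)\<^sup>2)))"
      by (simp add: mult.assoc exp_add[symmetric])
  qed
qed measurable

lemma gaussian_integral_pos: "0 < (LINT x|lborel. exp (- (norm (x::'a::euclidean_space))\<^sup>2))"
proof -
  have int: "integrable lborel (\<lambda>x::'a. exp (- (norm x)\<^sup>2))"
    using integrable_gaussian[of 1, where 'a='a] by simp
  have "(LINT x|lborel. exp (- (norm (x::'a))\<^sup>2)) \<noteq> 0"
  proof
    assume "(LINT x|lborel. exp (- (norm (x::'a))\<^sup>2)) = 0"
    then have "AE x::'a in lborel. exp (- (norm x)\<^sup>2) = 0"
      using integral_nonneg_eq_0_iff_AE[OF int] by simp
    then have "AE x::'a in lborel. False" by simp
    then show False
      by (simp add: AE_iff_null null_sets_def)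
  qed
  then show ?thesis
    by (simp add: less_le)
qed

lemma integral_lborel_diagonal_scaling:
  fixes F :: "real^'n::finite \<Rightarrow> 'b::{banach, second_countable_topology}"
  assumes R: "\<And>i. R i > 0" and F[measurable]: "F \<in> borel_measurable borel"
  shows "(LINT x|lborel. F x) = (\<Prod>i\<in>UNIV. R i) *\<^sub>R (LINT u|lborel. F (\<chi> i. R i * u $ i))"
proof -
  \<comment> \<open>The affine change of variables is indexed by basis vectors instead of
    coordinates; \<open>c\<close> carries \<open>R\<close> over to them.\<close>
  define c :: "real^'n \<Rightarrow> real" where "c b = (\<Sum>i\<in>UNIV. R i * b $ i)" for b
  have c: "c (axis i 1) = R i" for i
    by (simp add: c_def axis_def if_distrib[of "\<lambda>x. R _ * x"] cong: if_cong)
  have Basis: "(Basis :: (real^'n) set) = range (\<lambda>i. axis i 1)"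
    by (auto simp: Basis_vec_def)
  have inj: "inj (\<lambda>i::'n. axis i (1::real))"
    by (auto simp: inj_on_def axis_eq_axis)
  \<comment> \<open>The summand 0 is the translation part of the affine map.\<close>
  have T: "0 + (\<Sum>j\<in>Basis. (c j * (x \<bullet> j)) *\<^sub>R j) = (\<chi> i. R i * x $ i)" for x :: "real^'n"
    unfolding Basis sum.reindex[OF inj] o_def
    by (simp add: vec_eq_iff c inner_axis) (simp add: axis_def if_distrib[of "\<lambda>x. _ * x"] cong: if_cong)
  have prod: "(\<Prod>j\<in>Basis. \<bar>c j\<bar>) = (\<Prod>i\<in>UNIV. R i)"
    unfolding Basis prod.reindex[OF inj] o_def using R by (simp add: c less_imp_le)
  have nz: "c j \<noteq> 0" if "j \<in> Basis" for j
    using that R by (auto simp: Basis c less_imp_neq[THEN not_sym])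
  have meas: "(\<lambda>u::real^'n. (\<chi> i. R i * u $ i)) \<in> borel \<rightarrow>\<^sub>M borel"
    by (intro borel_measurable_continuous_onI continuous_intros)
  have eq: "(lborel :: (real^'n) measure)
      = density (distr lborel borel (\<lambda>u. (\<chi> i. R i * u $ i))) (\<lambda>_. ennreal (\<Prod>i\<in>UNIV. R i))"
    using lborel_affine_euclidean[of c 0, OF nz] unfolding T prod .
  have "(LINT x|lborel. F x)
      = (LINT x|density (distr lborel borel (\<lambda>u. (\<chi> i. R i * u $ i))) (\<lambda>_. ennreal (\<Prod>i\<in>UNIV. R i)). F x)"
    using eq by simp
  also have "\<dots> = (\<Prod>i\<in>UNIV. R i) *\<^sub>R (LINT u|lborel. F (\<chi> i. R i * u $ i))"
    using R meas by (subst integral_density) (auto simp: integral_distr prod_nonneg less_imp_le)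
  finally show ?thesis .
qed

section \<open>The modulated Gaussian: norm and image under the operator\<close>

text \<open>The factor \<open>exp (- i y\<^sub>k^m)\<close> cancels the phase of the operator at the pole \<open>x = e\<^sub>k\<close>.\<close>

definition knapp :: "'n::finite \<Rightarrow> nat \<Rightarrow> ('n \<Rightarrow> real) \<Rightarrow> real^'n \<Rightarrow> complex" where
  "knapp k m R y = exp (- (\<i> * complex_of_real ((y $ k) ^ m)) - complex_of_real (\<Sum>j\<in>UNIV. (y $ j / R j)\<^sup>2))"

lemma power2_norm_cart: "(norm x)\<^sup>2 = (\<Sum>j\<in>UNIV. (x $ j)\<^sup>2)" for x :: "real^'n::finite"
  unfolding power2_norm_eq_inner by (simp add: inner_vec_def power2_eq_square)

lemma continuous_on_knapp: "continuous_on S (knapp k m R)"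
  unfolding knapp_def divide_inverse by (intro continuous_intros)

lemma schwartz_knapp:
  fixes R :: "'n::finite \<Rightarrow> real"
  assumes R: "\<And>i. R i > 0"
  shows "schwartz (knapp k m R)"
proof -
  define \<phi> :: "real^'n \<Rightarrow> complex" where
    "\<phi> x = (- \<i>) * complex_of_real (x $ k) ^ m
      + (\<Sum>j\<in>UNIV. complex_of_real (- (1 / (R j)\<^sup>2)) * complex_of_real (x $ j) ^ 2)" for x
  \<comment> \<open>The slowest decay rate among the coordinates, which serves as the isotropic
    rate.\<close>
  define a where "a = Min (range (\<lambda>j. 1 / (R j)\<^sup>2))"
  have a: "a > 0"
    unfolding a_def using R by (subst Min_gr_iff) (auto simp: less_imp_neq[THEN not_sym])
  have "complex_poly \<phi>"
    unfolding \<phi>_def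
    by (intro complex_poly.intros complex_poly_sum complex_poly_power) auto
  moreover have "Re (\<phi> x) \<le> - (a * (norm x)\<^sup>2)" for x
  proof -
    have "a * (norm x)\<^sup>2 = (\<Sum>j\<in>UNIV. a * (x $ j)\<^sup>2)"
      by (simp add: power2_norm_cart sum_distrib_left)
    also have "\<dots> \<le> (\<Sum>j\<in>UNIV. (1 / (R j)\<^sup>2) * (x $ j)\<^sup>2)"
      unfolding a_def by (intro sum_mono mult_right_mono Min_le) auto
    also have "\<dots> = - Re (\<phi> x)"
      unfolding \<phi>_def of_real_power[symmetric] by (simp add: sum_negf)
    finally show ?thesis by simp
  qed
  ultimately have "schwartz (\<lambda>x. 1 * exp (\<phi> x))"
    using a by (intro schwartz_poly_exp complex_poly.const)
  also have "(\<lambda>x. 1 * exp (\<phi> x)) = knapp k m R"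
    by (simp add: fun_eq_iff knapp_def \<phi>_def power_divide sum_negf)
  finally show ?thesis .
qed

text \<open>The modulation is unimodular, and rescaling by \<open>R\<close> makes the modulus a
  standard Gaussian, leaving only a power of the Jacobian.\<close>

lemma Lp_norm_knapp:
  fixes R :: "'n::finite \<Rightarrow> real"
  assumes R: "\<And>i. R i > 0"
  shows "Lp_norm p (knapp k m R) = (\<Prod>i\<in>UNIV. R i) powr (1 / p) *
    (LINT u|lborel. exp (- (norm (u::real^'n))\<^sup>2) powr p) powr (1 / p)"
proof -
  have [measurable]: "knapp k m R \<in> borel_measurable borel"
    by (intro borel_measurable_continuous_onI continuous_on_knapp)
  have scaled: "cmod (knapp k m R (\<chi> i. R i * u $ i)) = exp (- (norm u)\<^sup>2)" for u
    using R[THEN less_imp_neq] by (simp add: knapp_def power2_norm_cart)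
  have "(LINT y|lborel. cmod (knapp k m R y) powr p)
      = (\<Prod>i\<in>UNIV. R i) *\<^sub>R (LINT u|lborel. cmod (knapp k m R (\<chi> i. R i * u $ i)) powr p)"
    using R by (rule integral_lborel_diagonal_scaling) measurable
  then show ?thesis
    using R by (simp add: scaled Lp_norm_def powr_mult prod_nonneg less_imp_le)
qed

text \<open>After rescaling by \<open>R\<close>, all dependence on \<open>x\<close> and
  \<open>R\<close> besides the Jacobian sits in the phase coefficients; the modulation contributes
  the -1 at \<open>k\<close>, so that all of them vanish at the pole when every \<alpha> is
  positive.\<close>

lemma T_op_knapp:
  fixes R :: "'n::finite \<Rightarrow> real"
  assumes R: "\<And>i. R i > 0"
  shows "T_op \<alpha> m (knapp k m R) x = complex_of_real (\<Prod>i\<in>UNIV. R i) *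
    (LINT u|lborel. exp (\<i> * complex_of_real
        (\<Sum>i\<in>UNIV. (((x $ i) ^ \<alpha> i - (if i = k then 1 else 0)) * R i ^ m) * (u $ i) ^ m))
      * complex_of_real (exp (- (norm u)\<^sup>2)))"
proof -
  have meas: "(\<lambda>y. exp (\<i> * complex_of_real (\<Sum>i\<in>UNIV. (x $ i) ^ \<alpha> i * (y $ i) ^ m)) * knapp k m R y)
      \<in> borel_measurable borel"
    by (intro borel_measurable_continuous_onI continuous_intros continuous_on_knapp)
  have integrand: "exp (\<i> * complex_of_real (\<Sum>i\<in>UNIV. (x $ i) ^ \<alpha> i * (R i * u $ i) ^ m))
        * knapp k m R (\<chi> i. R i * u $ i)
      = exp (\<i> * complex_of_real
        (\<Sum>i\<in>UNIV. (((x $ i) ^ \<alpha> i - (if i = k then 1 else 0)) * R i ^ m) * (u $ i) ^ m))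
      * complex_of_real (exp (- (norm u)\<^sup>2))" for u :: "real^'n"
  proof -
    have "(\<Sum>i\<in>UNIV. (((x $ i) ^ \<alpha> i - (if i = k then 1 else 0)) * R i ^ m) * (u $ i) ^ m)
        = (\<Sum>i\<in>UNIV. (x $ i) ^ \<alpha> i * (R i * u $ i) ^ m - (if i = k then (R k * u $ k) ^ m else 0))"
      by (intro sum.cong) (auto simp: power_mult_distrib algebra_simps)
    also have "\<dots> = (\<Sum>i\<in>UNIV. (x $ i) ^ \<alpha> i * (R i * u $ i) ^ m) - (R k * u $ k) ^ m"
      by (simp add: sum_subtractf)
    finally have phase: "(\<Sum>i\<in>UNIV. (((x $ i) ^ \<alpha> i - (if i = k then 1 else 0)) * R i ^ m) * (u $ i) ^ m)
        = (\<Sum>i\<in>UNIV. (x $ i) ^ \<alpha> i * (R i * u $ i) ^ m) - (R k * u $ k) ^ m" .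
    have "(\<Sum>j\<in>UNIV. ((R j * u $ j) / R j)\<^sup>2) = (norm u)\<^sup>2"
      using R[THEN less_imp_neq] by (simp add: power2_norm_cart)
    then show ?thesis
      unfolding phase knapp_def
      by (simp only: vec_lambda_beta exp_of_real[symmetric] exp_add[symmetric] of_real_diff
          right_diff_distrib of_real_minus) (simp add: algebra_simps)
  qed
  show ?thesis
    unfolding T_op_def integral_lborel_diagonal_scaling[of R, OF R meas] vec_lambda_beta integrand
      scaleR_conv_of_real ..
qed

text \<open>The left side equals 2 |sin (t/2)|.\<close>

lemma norm_exp_i_minus_one_le: "cmod (exp (\<i> * complex_of_real t) - 1) \<le> \<bar>t\<bar>"
  using dist_exp_i_1[of t] abs_sin_x_le_abs_x[of "t / 2"] by simp

text \<open>The \<open>itself\<close> argument fixes the dimension, which neither \<open>m\<close>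
  nor the result type determines.\<close>

definition gaussian_moment_sum :: "'n::finite itself \<Rightarrow> nat \<Rightarrow> real" where
  "gaussian_moment_sum _ m = (\<Sum>i\<in>UNIV. LINT u|lborel. \<bar>(u::real^'n) $ i\<bar> ^ m * exp (- (norm u)\<^sup>2))"

lemma gaussian_moment_sum_nonneg: "0 \<le> gaussian_moment_sum TYPE('n::finite) m"
  unfolding gaussian_moment_sum_def by (intro sum_nonneg integral_nonneg_AE) auto

text \<open>Small phase coefficients cannot cause cancellation: replacing the oscillating factor by
  1 costs at most the integral of the absolute phase against the Gaussian, a sum of absolute
  moments.\<close>

lemma oscillating_gaussian_lower_bound:
  fixes c :: "'n::finite \<Rightarrow> real"
  assumes c: "\<And>i. \<bar>c i\<bar> \<le> \<epsilon>"
  shows "(LINT u|lborel. exp (- (norm (u::real^'n))\<^sup>2)) - \<epsilon> * gaussian_moment_sum TYPE('n) m \<le>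
    cmod (LINT u|lborel. exp (\<i> * complex_of_real (\<Sum>i\<in>UNIV. c i * (u $ i) ^ m))
      * complex_of_real (exp (- (norm (u::real^'n))\<^sup>2)))"
proof -
  let ?g = "\<lambda>u::real^'n. exp (- (norm u)\<^sup>2)"
  let ?h = "\<lambda>u::real^'n. exp (\<i> * complex_of_real (\<Sum>i\<in>UNIV. c i * (u $ i) ^ m)) * complex_of_real (?g u)"
  have g: "integrable lborel ?g"
    using integrable_gaussian[of 1, where 'a="real^'n"] by simp
  have gc: "integrable lborel (\<lambda>u. complex_of_real (?g u))"
    using g by simp
  have [measurable]: "?h \<in> borel_measurable borel"
    by (intro borel_measurable_continuous_onI continuous_intros)
  have h: "integrable lborel ?h"
    by (rule Bochner_Integration.integrable_bound[OF g]) (auto simp: norm_mult)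
  have "cmod ((LINT u|lborel. ?h u) - (LINT u|lborel. complex_of_real (?g u)))
      = cmod (LINT u|lborel. ?h u - complex_of_real (?g u))"
    using h gc by simp
  also have "\<dots> \<le> (LINT u|lborel. cmod (?h u - complex_of_real (?g u)))"
    by (rule integral_norm_bound)
  also have "\<dots> \<le> (LINT u|lborel. (\<Sum>i\<in>UNIV. \<epsilon> * (\<bar>u $ i\<bar> ^ m * ?g u)))"
  proof (rule integral_mono)
    show "integrable lborel (\<lambda>u. cmod (?h u - complex_of_real (?g u)))"
      using h gc by simp
    show "integrable lborel (\<lambda>u. (\<Sum>i\<in>UNIV. \<epsilon> * (\<bar>u $ i\<bar> ^ m * ?g u)))"
      by (intro Bochner_Integration.integrable_sum integrable_mult_right integrable_power_gaussian)
    fix u :: "real^'n"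
    have "cmod (?h u - complex_of_real (?g u))
        = cmod (exp (\<i> * complex_of_real (\<Sum>i\<in>UNIV. c i * (u $ i) ^ m)) - 1) * ?g u"
    proof -
      have "z * complex_of_real r - complex_of_real r = (z - 1) * complex_of_real r" for z r
        by (simp add: left_diff_distrib)
      from this show ?thesis
        by (simp only: norm_mult norm_of_real abs_exp_cancel)
    qed
    also have "\<dots> \<le> \<bar>\<Sum>i\<in>UNIV. c i * (u $ i) ^ m\<bar> * ?g u"
      by (intro mult_right_mono norm_exp_i_minus_one_le) auto
    also have "\<dots> \<le> (\<Sum>i\<in>UNIV. \<epsilon> * \<bar>u $ i\<bar> ^ m) * ?g u"
      using c by (intro mult_right_mono order_trans[OF sum_abs] sum_mono)
        (auto simp: abs_mult power_abs intro: mult_right_mono)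
    finally show "cmod (?h u - complex_of_real (?g u)) \<le> (\<Sum>i\<in>UNIV. \<epsilon> * (\<bar>u $ i\<bar> ^ m * ?g u))"
      by (simp add: sum_distrib_right mult.assoc)
  qed
  also have "\<dots> = \<epsilon> * gaussian_moment_sum TYPE('n) m"
    unfolding gaussian_moment_sum_def
    by (subst Bochner_Integration.integral_sum)
      (auto simp: sum_distrib_left intro!: integrable_mult_right integrable_power_gaussian)
  finally have "cmod ((LINT u|lborel. ?h u) - complex_of_real (LINT u|lborel. ?g u))
      \<le> \<epsilon> * gaussian_moment_sum TYPE('n) m"
    by simp
  moreover have "cmod (complex_of_real (LINT u|lborel. ?g u)) = (LINT u|lborel. ?g u)"
    using gaussian_integral_pos[where 'a="real^'n"] by simp
  ultimately show ?thesis
    using norm_triangle_ineq2[of "complex_of_real (LINT u|lborel. ?g u)" "LINT u|lborel. ?h u"]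
    by (simp add: norm_minus_commute)
qed

text \<open>A crude bound, uniform in \<open>x\<close>, which makes the spherical integrand bounded
  and hence integrable.\<close>

lemma T_op_knapp_le:
  fixes R :: "'n::finite \<Rightarrow> real"
  assumes R: "\<And>i. R i > 0"
  shows "cmod (T_op \<alpha> m (knapp k m R) x)
    \<le> (\<Prod>i\<in>UNIV. R i) * (LINT u|lborel. exp (- (norm (u::real^'n))\<^sup>2))"
  unfolding T_op_knapp[OF R] norm_mult
  using R
  by (intro mult_mono order_trans[OF integral_norm_bound])
    (auto simp: norm_mult prod_nonneg less_imp_le simp del: of_real_sum of_real_prod)

text \<open>The integrand is jointly continuous, hence product measurable, and integrating out one
  variable preserves measurability.\<close>

lemma borel_measurable_T_op:
  fixes f :: "real^'n::finite \<Rightarrow> complex"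
  assumes "continuous_on UNIV f"
  shows "T_op \<alpha> m f \<in> borel_measurable borel"
proof -
  have "(\<lambda>z::(real^'n) \<times> (real^'n). exp (\<i> * complex_of_real (\<Sum>i\<in>UNIV. (fst z $ i) ^ \<alpha> i * (snd z $ i) ^ m)) * f (snd z))
      \<in> borel_measurable borel"
    by (intro borel_measurable_continuous_onI continuous_intros
        continuous_on_compose2[OF assms]) auto
  then have "(\<lambda>z::(real^'n) \<times> (real^'n). exp (\<i> * complex_of_real (\<Sum>i\<in>UNIV. (fst z $ i) ^ \<alpha> i * (snd z $ i) ^ m)) * f (snd z))
      \<in> borel_measurable (borel \<Otimes>\<^sub>M lborel)"
    by (simp add: borel_prod[symmetric] cong: measurable_cong_sets sets_pair_measure_cong)
  then show ?thesis
    unfolding T_op_def[abs_def]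
    by (intro lborel.borel_measurable_lebesgue_integral) (simp add: case_prod_beta')
qed

section \<open>Lower bound for spherical integrals over a cap\<close>

text \<open>In the cone description of surface measure, it suffices to find a box in the unit ball
  whose radial projection lies in the cap; its volume is of order \<delta>^(n-1).\<close>

lemma sphere_integral_cap_lower_bound:
  fixes g :: "real^'n::finite \<Rightarrow> real" and k :: 'n
  assumes g[measurable]: "g \<in> borel_measurable borel"
    and bounds: "\<And>x. 0 \<le> g x" "\<And>x. g x \<le> B"
    and \<delta>: "0 < \<delta>" "\<delta> \<le> 1"
    and cap: "\<And>x. norm x = 1 \<Longrightarrow> x $ k \<ge> 0 \<Longrightarrow> (\<And>j. j \<noteq> k \<Longrightarrow> \<bar>x $ j\<bar> \<le> \<delta>) \<Longrightarrow> c \<le> g x"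
  shows "c * (1/4 * (\<delta> / (2 * real CARD('n))) ^ (CARD('n) - 1)) \<le> sphere_integral g"
proof -
  let ?n = "real CARD('n)"
  have n: "?n \<ge> 1" by (simp add: Suc_le_eq)
  \<comment> \<open>Keeping \<open>x $ k\<close> at least 1/4 bounds the norm below, so normalising
    enlarges the other coordinates at most fourfold; the factor 1/n keeps the box inside the
    ball.\<close>
  define l u :: "real^'n" where "l = (\<chi> j. if j = k then 1/4 else - (\<delta> / (4 * ?n)))"
    and "u = (\<chi> j. if j = k then 1/2 else \<delta> / (4 * ?n))"
  have lu: "l $ i \<le> u $ i" for i
    using \<delta> n by (simp add: l_def u_def)
  have "measure lborel (cbox l u) = (\<Prod>i\<in>UNIV. u $ i - l $ i)"
    using lu by (subst content_cbox_cart) (auto simp: interval_eq_empty_cart not_less)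
  also have "\<dots> = (\<Prod>i\<in>UNIV. if i = k then 1/4 else \<delta> / (2 * ?n))"
    by (intro prod.cong) (auto simp: l_def u_def)
  also have "\<dots> = 1/4 * (\<delta> / (2 * ?n)) ^ (CARD('n) - 1)"
    by (subst prod.remove[of _ k]) (auto simp: card_Diff_singleton)
  finally have vol: "measure lborel (cbox l u) = 1/4 * (\<delta> / (2 * ?n)) ^ (CARD('n) - 1)" .
  have box: "x \<in> ball 0 1 - {0} \<and> c \<le> g (x /\<^sub>R norm x)" if "x \<in> cbox l u" for x
  proof -
    have xk: "1/4 \<le> x $ k" "x $ k \<le> 1/2"
      and xj: "j \<noteq> k \<Longrightarrow> \<bar>x $ j\<bar> \<le> \<delta> / (4 * ?n)" for j
      using that[unfolded mem_box_cart] by (auto simp: l_def u_def abs_le_iff split: if_splits)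
    have small: "\<delta> / (4 * ?n) \<le> 1 / (4 * ?n)"
      using \<delta> n by (simp add: divide_right_mono)
    have "norm x \<le> (\<Sum>j\<in>UNIV. \<bar>x $ j\<bar>)"
      by (rule norm_le_l1_cart)
    also have "\<dots> \<le> (\<Sum>j\<in>UNIV. (if j = k then 1/2 else 0) + 1 / (4 * ?n))"
    proof (rule sum_mono)
      fix j show "\<bar>x $ j\<bar> \<le> (if j = k then 1/2 else 0) + 1 / (4 * ?n)"
        using xk xj[of j] small n by (auto simp: add_increasing2)
    qed
    \<comment> \<open>The sum is 1/2 + n / (4 n) = 3/4.\<close>
    also have "\<dots> < 1"
      by (simp add: sum.distrib)
    finally have norm1: "norm x < 1" .
    have norm4: "1/4 \<le> norm x"
      using component_le_norm_cart[of x k] xk by simp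
    then have norm_nz: "norm x \<noteq> 0" by linarith
    have "c \<le> g (x /\<^sub>R norm x)"
    proof (rule cap)
      show "norm (x /\<^sub>R norm x) = 1" using norm_nz by simp
      show "(x /\<^sub>R norm x) $ k \<ge> 0" using xk by simp
      fix j assume "j \<noteq> k"
      then have "\<bar>x $ j\<bar> \<le> \<delta> * (1/4)"
        using xj[of j] n \<delta> mult_left_mono[of "1 / ?n" 1 \<delta>] by simp
      also have "\<dots> \<le> \<delta> * norm x"
        using norm4 \<delta> by (intro mult_left_mono) auto
      finally show "\<bar>(x /\<^sub>R norm x) $ j\<bar> \<le> \<delta>"
        using norm_nz by (simp add: abs_mult divide_simps)
    qed
    then show ?thesis
      using norm1 norm4 by auto
  qed
  let ?F = "\<lambda>x. indicator (ball 0 1 - {0}) x * g (x /\<^sub>R norm x)"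
  have "integrable lborel (\<lambda>x::real^'n. indicator (ball 0 1) x * B)"
    using emeasure_lborel_ball_finite[of "0::real^'n" 1]
    by (intro integrable_mult_left integrable_real_indicator) auto
  \<comment> \<open>Monotonicity of the Bochner integral requires integrability; this is where the
    upper bound \<open>B\<close> enters.\<close>
  then have F: "integrable lborel ?F"
  proof (rule Bochner_Integration.integrable_bound)
    have "\<bar>g y\<bar> \<le> \<bar>B\<bar>" for y
      using bounds[of y] by simp
    then show "AE x in lborel. norm (?F x) \<le> norm (indicator (ball 0 1) x * B)"
      by (auto simp: indicator_def)
    have "(\<lambda>x::real^'n. g (x /\<^sub>R norm x)) \<in> borel_measurable borel"
      by measurable
    then show "?F \<in> borel_measurable lborel"
      by (intro borel_measurable_times borel_measurable_indicator) auto
  qed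
  have I: "integrable lborel (\<lambda>x. indicator (cbox l u) x * c)"
    using emeasure_lborel_cbox_finite[of l u]
    by (intro integrable_mult_left integrable_real_indicator) auto
  have "c * measure lborel (cbox l u) = (LINT x|lborel. indicator (cbox l u) x * c)"
    by simp
  also have "\<dots> \<le> (LINT x|lborel. ?F x)"
    using box bounds by (intro integral_mono[OF I F]) (auto simp: indicator_def)
  also have "\<dots> \<le> sphere_integral g"
    unfolding sphere_integral_def
    using mult_right_mono[OF n, of "LINT x|lborel. ?F x"] bounds(1) by (simp add: integral_nonneg_AE)
  finally show ?thesis
    unfolding vol .
qed

section \<open>Comparing exponents and controlling the phase on the cap\<close>

lemma powr_exponent_le:
  fixes C D a b :: real
  assumes C: "C > 0" and le: "\<And>s. s \<ge> 1 \<Longrightarrow> C * s powr a \<le> D * s powr b"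
  shows "a \<le> b"
proof (rule ccontr)
  assume "\<not> a \<le> b"
  then have ab: "a - b > 0" by simp
  \<comment> \<open>Chosen so that \<open>s powr (a - b)\<close> exceeds D / C; the maximum with 1
    gives s \<ge> 1 even for negative D.\<close>
  define s where "s = (max 1 (D / C + 1)) powr (1 / (a - b))"
  have s1: "s \<ge> 1"
    unfolding s_def using ab by (intro ge_one_powr_ge_zero) auto
  have "s powr (a - b) = max 1 (D / C + 1)"
    unfolding s_def using ab by (simp add: powr_powr)
  then have "D / C < s powr (a - b)" by simp
  then have "D < C * s powr (a - b)"
    using C by (simp add: field_simps)
  also have "\<dots> = C * s powr a / s powr b"
    using s1 by (simp add: powr_diff)
  also have "\<dots> \<le> D"
    using le[OF s1] s1 by (simp add: field_simps)
  finally show False by simp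
qed

text \<open>The scales match the cap: for i \<noteq> k the factor s^(\<alpha> i * m) cancels the
  smallness of x_i^(\<alpha> i), while at the pole 1 - x_k is quadratic in the cap radius s^(-m),
  which permits the larger power s^2. What remains is a bound independent of \<open>s\<close> and
  proportional to \<open>c\<close>.\<close>

lemma knapp_phase_coefficient_le:
  fixes \<alpha> :: "'n::finite \<Rightarrow> nat" and x :: "real^'n"
  assumes m: "m > 0" and c0: "0 < c" "c \<le> 1" and s: "s \<ge> 1"
    and x: "norm x = 1" "x $ k \<ge> 0" and cap: "\<And>j. j \<noteq> k \<Longrightarrow> \<bar>x $ j\<bar> \<le> 1 / s ^ m"
  shows "\<bar>((x $ i) ^ \<alpha> i - (if i = k then 1 else 0)) * (c * s ^ (if i = k then 2 else \<alpha> i)) ^ m\<bar>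
    \<le> c * (1 + real (\<alpha> k) * real CARD('n))"
proof -
  have cm: "c ^ m \<le> c"
    using power_decreasing[of 1 m c] m c0 by (simp add: Suc_le_eq)
  have cm_mult: "c ^ m * t \<le> c * (1 + real (\<alpha> k) * real CARD('n))"
    if "0 \<le> t" "t \<le> 1 + real (\<alpha> k) * real CARD('n)" for t
    using that cm c0 by (intro mult_mono) auto
  show ?thesis
  proof (cases "i = k")
    case False
    have "\<bar>x $ i\<bar> ^ \<alpha> i \<le> (1 / s ^ m) ^ \<alpha> i"
      using cap[OF False] by (intro power_mono) auto
    then have "\<bar>x $ i\<bar> ^ \<alpha> i * (s ^ \<alpha> i) ^ m \<le> 1"
      using s by (simp add: power_divide divide_simps power_mult[symmetric] mult.commute)
    then have "c ^ m * (\<bar>x $ i\<bar> ^ \<alpha> i * (s ^ \<alpha> i) ^ m) \<le> c * (1 + real (\<alpha> k) * real CARD('n))"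
      using s by (intro cm_mult) (auto intro: order_trans add_increasing2)
    then show ?thesis
      using False c0 s by (simp add: abs_mult power_abs power_mult_distrib mult_ac)
  next
    case True
    have xk1: "x $ k \<le> 1"
      using component_le_norm_cart[of x k] x by simp
    \<comment> \<open>Bernoulli's inequality linearises the power; below, 1 - x_k \<le> 1 - x_k^2
      turns the deficit into the sum of the squared small coordinates.\<close>
    have "1 + real (\<alpha> k) * (x $ k - 1) \<le> (x $ k) ^ \<alpha> k"
      using Bernoulli_inequality[of "x $ k - 1" "\<alpha> k"] x by simp
    moreover have "(x $ k) ^ \<alpha> k \<le> 1"
      using x xk1 by (intro power_le_one)
    ultimately have "\<bar>(x $ k) ^ \<alpha> k - 1\<bar> \<le> real (\<alpha> k) * (1 - x $ k)"
      by (simp add: algebra_simps)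
    also have "1 - x $ k \<le> 1 - (x $ k)\<^sup>2"
      using x xk1 by (simp add: power2_eq_square mult_left_le)
    also have "1 - (x $ k)\<^sup>2 = (\<Sum>j\<in>UNIV - {k}. (x $ j)\<^sup>2)"
    proof -
      have "(\<Sum>j\<in>UNIV. (x $ j)\<^sup>2) = 1"
        using x power2_norm_cart[of x] by simp
      then show ?thesis
        by (simp add: sum.remove[of UNIV k])
    qed
    also have "\<dots> \<le> (\<Sum>j\<in>UNIV - {k}. (1 / s ^ m)\<^sup>2)"
      using cap s by (intro sum_mono) (auto simp: abs_le_square_iff[symmetric])
    also have "\<dots> \<le> real CARD('n) * (1 / s ^ m)\<^sup>2"
      unfolding sum_constant by (intro mult_right_mono) (auto intro: card_mono)
    finally have "\<bar>(x $ k) ^ \<alpha> k - 1\<bar> \<le> real (\<alpha> k) * (real CARD('n) * (1 / s ^ m)\<^sup>2)"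
      by (simp add: mult_left_mono)
    then have "\<bar>(x $ k) ^ \<alpha> k - 1\<bar> * (s\<^sup>2) ^ m \<le> (real (\<alpha> k) * (real CARD('n) * (1 / s ^ m)\<^sup>2)) * (s\<^sup>2) ^ m"
      using s by (intro mult_right_mono) auto
    also have "\<dots> = real (\<alpha> k) * real CARD('n)"
      using s by (simp add: power_divide power_mult[symmetric] mult.commute)
    finally have "c ^ m * (\<bar>(x $ k) ^ \<alpha> k - 1\<bar> * (s\<^sup>2) ^ m) \<le> c * (1 + real (\<alpha> k) * real CARD('n))"
      using s by (intro cm_mult) auto
    then show ?thesis
      using True c0 s by (simp add: abs_mult power_mult_distrib mult_ac)
  qed
qed

text \<open>The assumption \<open>small\<close> limits the phase error to half of the Gaussian
  integral throughout the cap of radius s^(-m).\<close>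

lemma T_op_knapp_sphere_lower_bound:
  fixes \<alpha> :: "'n::finite \<Rightarrow> nat" and k :: 'n
  assumes m: "m > 0" and c: "0 < c" "c \<le> 1" and s: "s \<ge> 1"
    and small: "c * (1 + real (\<alpha> k) * real CARD('n)) * gaussian_moment_sum TYPE('n) m
      \<le> (LINT u|lborel. exp (- (norm (u::real^'n))\<^sup>2)) / 2"
    and R_def: "R = (\<lambda>i. c * s ^ (if i = k then 2 else \<alpha> i))"
  shows "((\<Prod>i\<in>UNIV. R i) * ((LINT u|lborel. exp (- (norm (u::real^'n))\<^sup>2)) / 2))\<^sup>2
      * (1/4 * ((1 / s ^ m) / (2 * real CARD('n))) ^ (CARD('n) - 1))
    \<le> sphere_integral (\<lambda>x. (cmod (T_op \<alpha> m (knapp k m R) x))\<^sup>2)"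
proof -
  let ?G = "LINT u|lborel. exp (- (norm (u::real^'n))\<^sup>2)"
  have R: "R i > 0" for i
    using c s by (simp add: R_def)
  have prod_R: "(\<Prod>i\<in>UNIV. R i) > 0"
    using R by (intro prod_pos) auto
  show ?thesis
  proof (rule sphere_integral_cap_lower_bound[where k = k and B = "((\<Prod>i\<in>UNIV. R i) * ?G)\<^sup>2"])
    show "(\<lambda>x. (cmod (T_op \<alpha> m (knapp k m R) x))\<^sup>2) \<in> borel_measurable borel"
      using borel_measurable_T_op[OF continuous_on_knapp, of \<alpha> m k m R] by measurable
    show "(cmod (T_op \<alpha> m (knapp k m R) x))\<^sup>2 \<le> ((\<Prod>i\<in>UNIV. R i) * ?G)\<^sup>2" for x
      using T_op_knapp_le[OF R] by (intro power_mono) auto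
    fix x :: "real^'n"
    assume x: "norm x = 1" "x $ k \<ge> 0" "\<And>j. j \<noteq> k \<Longrightarrow> \<bar>x $ j\<bar> \<le> 1 / s ^ m"
    define d where "d i = ((x $ i) ^ \<alpha> i - (if i = k then 1 else 0)) * R i ^ m" for i
    have "\<bar>d i\<bar> \<le> c * (1 + real (\<alpha> k) * real CARD('n))" for i
      unfolding d_def R_def by (rule knapp_phase_coefficient_le[OF m c s x])
    then have "?G / 2 \<le> cmod (LINT u|lborel. exp (\<i> * complex_of_real (\<Sum>i\<in>UNIV. d i * (u $ i) ^ m))
        * complex_of_real (exp (- (norm (u::real^'n))\<^sup>2)))"
      using oscillating_gaussian_lower_bound[of d, where m = m] small by fastforce
    then have "(\<Prod>i\<in>UNIV. R i) * (?G / 2) \<le> cmod (T_op \<alpha> m (knapp k m R) x)"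
      unfolding T_op_knapp[of R, OF R] norm_mult norm_of_real d_def[symmetric] using prod_R by simp
    then show "((\<Prod>i\<in>UNIV. R i) * (?G / 2))\<^sup>2 \<le> (cmod (T_op \<alpha> m (knapp k m R) x))\<^sup>2"
      using prod_R gaussian_integral_pos[where 'a = "real^'n"] by (intro power_mono) auto
  qed (use s in auto)
qed

section \<open>The necessary condition on the exponent\<close>

text \<open>Both sides of the tested inequality are constants times powers of \<open>s\<close>, so
  letting \<open>s\<close> grow compares the exponents. The pole \<open>k\<close> is arbitrary here;
  the minimising one is chosen only in the theorem.\<close>

lemma restriction_exponent_inequality:
  fixes \<alpha> :: "'n::finite \<Rightarrow> nat" and p A :: real
  assumes m: "m > 0"
    and bound: "\<And>f. schwartz f \<Longrightarrow>
        sqrt (sphere_integral (\<lambda>x. (cmod (T_op \<alpha> m f x))\<^sup>2)) \<le> A * Lp_norm p f"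
  shows "real (2 + (\<Sum>j\<in>UNIV - {k}. \<alpha> j)) - real m * real (CARD('n) - 1) / 2
    \<le> real (2 + (\<Sum>j\<in>UNIV - {k}. \<alpha> j)) * (1 / p)"
proof -
  let ?G = "LINT u|lborel. exp (- (norm (u::real^'n))\<^sup>2)"
  let ?K = "LINT u|lborel. exp (- (norm (u::real^'n))\<^sup>2) powr p"
  let ?n = "CARD('n)"
  define e where "e = 2 + (\<Sum>j\<in>UNIV - {k}. \<alpha> j)"
  define b where "b = (1 + real (\<alpha> k) * real ?n) * gaussian_moment_sum TYPE('n) m"
  have G: "?G > 0" by (rule gaussian_integral_pos)
  have b: "b \<ge> 0"
    unfolding b_def by (intro mult_nonneg_nonneg gaussian_moment_sum_nonneg) auto
  \<comment> \<open>Independent of \<open>s\<close>, with c * b \<le> ?G / 2; adding 1 to the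
    denominator covers b = 0.\<close>
  define c where "c = min 1 (?G / 2 / (b + 1))"
  have c: "0 < c" "c \<le> 1" using G b by (auto simp: c_def)
  have "c * b \<le> (?G / 2 / (b + 1)) * b"
    using b by (intro mult_right_mono) (auto simp: c_def)
  also have "\<dots> \<le> ?G / 2"
    using b G by (simp add: divide_simps mult_left_mono)
  finally have small: "c * (1 + real (\<alpha> k) * real ?n) * gaussian_moment_sum TYPE('n) m \<le> ?G / 2"
    by (simp add: b_def mult.assoc)
  \<comment> \<open>\<open>C\<close> and \<open>D\<close> collect the factors free of
    \<open>s\<close> on the two sides.\<close>
  define C where "C = c ^ ?n * (?G / 2) * sqrt (1/4 * (1 / (2 * real ?n)) ^ (?n - 1))"
  define D where "D = A * ((c ^ ?n) powr (1 / p) * ?K powr (1 / p))"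
  have "real e - real m * real (?n - 1) / 2 \<le> real e * (1 / p)"
  proof (rule powr_exponent_le)
    show "C > 0" using c G by (auto simp: C_def)
    fix s :: real assume s: "s \<ge> 1"
    define R where "R = (\<lambda>i. c * s ^ (if i = k then 2 else \<alpha> i))"
    have R: "R i > 0" for i
      using c s by (simp add: R_def)
    have prod_R: "(\<Prod>i\<in>UNIV. R i) = c ^ ?n * s ^ e"
    proof -
      have "(\<Prod>i\<in>UNIV. R i) = c ^ ?n * s ^ (\<Sum>i\<in>UNIV. if i = k then 2 else \<alpha> i)"
        by (simp add: R_def prod.distrib power_sum)
      also have "(\<Sum>i\<in>UNIV. if i = k then 2 else \<alpha> i) = e"
        by (subst sum.remove[of _ k]) (auto simp: e_def intro!: sum.cong)
      finally show ?thesis .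
    qed
    have "sqrt (((\<Prod>i\<in>UNIV. R i) * (?G / 2))\<^sup>2 * (1/4 * ((1 / s ^ m) / (2 * real ?n)) ^ (?n - 1)))
        \<le> A * Lp_norm p (knapp k m R)"
      using T_op_knapp_sphere_lower_bound[OF m c s small R_def] bound[OF schwartz_knapp[of R, OF R]]
      by (meson order_trans real_sqrt_le_mono)
    also have "A * Lp_norm p (knapp k m R) = D * s powr (real e * (1 / p))"
      using c s by (simp add: Lp_norm_knapp[of R, OF R] prod_R D_def powr_mult powr_powr
          powr_realpow[symmetric])
    also have "sqrt (((\<Prod>i\<in>UNIV. R i) * (?G / 2))\<^sup>2 * (1/4 * ((1 / s ^ m) / (2 * real ?n)) ^ (?n - 1)))
        = C * s powr (real e - real m * real (?n - 1) / 2)"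
    proof -
      \<comment> \<open>The square root of the cap measure is the source of the loss m (n-1) / 2 in
        the exponent.\<close>
      have "sqrt ((1 / s ^ m) ^ (?n - 1)) = s powr (- (real m * real (?n - 1) / 2))"
        using s by (simp add: power_divide power_mult[symmetric] powr_half_sqrt[symmetric]
            powr_realpow[symmetric] powr_powr powr_minus powr_divide divide_simps)
      moreover have "(1/4::real) * ((1 / s ^ m) / (2 * real ?n)) ^ (?n - 1)
          = (1/4 * (1 / (2 * real ?n)) ^ (?n - 1)) * (1 / s ^ m) ^ (?n - 1)"
        by (simp add: power_divide power_mult_distrib)
      ultimately have "sqrt (1/4 * ((1 / s ^ m) / (2 * real ?n)) ^ (?n - 1))
          = sqrt (1/4 * (1 / (2 * real ?n)) ^ (?n - 1)) * s powr (- (real m * real (?n - 1) / 2))"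
        by (simp only: real_sqrt_mult)
      moreover have "sqrt (((\<Prod>i\<in>UNIV. R i) * (?G / 2))\<^sup>2) = c ^ ?n * (?G / 2) * s powr real e"
        unfolding prod_R using c s G by (simp add: powr_realpow)
      moreover have "s powr (real e - real m * real (?n - 1) / 2)
          = s powr real e * s powr (- (real m * real (?n - 1) / 2))"
        by (simp add: powr_add[symmetric])
      ultimately show ?thesis
        unfolding real_sqrt_mult[of "_\<^sup>2"] by (simp only: C_def mult_ac)
    qed
    finally show "C * s powr (real e - real m * real (?n - 1) / 2) \<le> D * s powr (real e * (1 / p))" .
  qed
  then show ?thesis
    unfolding e_def .
qed

theorem theorem2:
  fixes \<alpha> :: "'n::finite \<Rightarrow> nat" and m :: nat and p A :: real
  assumes n2: "CARD('n) \<ge> 2"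
    and m_pos: "m > 0"
    and \<alpha>_pos: "\<forall>i. \<alpha> i > 0"
    and p_ge: "p \<ge> 1"
    and bound: "\<forall>f. schwartz f \<longrightarrow>
        sqrt (sphere_integral (\<lambda>x. (cmod (T_op \<alpha> m f x))\<^sup>2)) \<le> A * Lp_norm p f"
    and cond: "2 * (2 + real (Min (range (\<lambda>i. \<Sum>j\<in>UNIV - {i}. \<alpha> j))))
               > real (CARD('n) - 1) * real m"
  shows "1 \<le> p \<and>
         p \<le> 2 * (2 + real (Min (range (\<lambda>i. \<Sum>j\<in>UNIV - {i}. \<alpha> j)))) /
              (2 * (2 + real (Min (range (\<lambda>i. \<Sum>j\<in>UNIV - {i}. \<alpha> j))))
               - real (CARD('n) - 1) * real m)"
proof
  define S where "S = Min (range (\<lambda>i. \<Sum>j\<in>UNIV - {i}. \<alpha> j))"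
  have "S \<in> range (\<lambda>i. \<Sum>j\<in>UNIV - {i}. \<alpha> j)"
    unfolding S_def by (rule Min_in) auto
  then obtain k where k: "S = (\<Sum>j\<in>UNIV - {k}. \<alpha> j)"
    by auto
  have "real (2 + S) - real m * real (CARD('n) - 1) / 2 \<le> real (2 + S) * (1 / p)"
    unfolding k using bound m_pos by (intro restriction_exponent_inequality) auto
  \<comment> \<open>Multiplication by 2 p, which is positive; \<open>cond\<close> then allows
    division by the bracket.\<close>
  then have "(2 * (2 + real S) - real (CARD('n) - 1) * real m) * p \<le> 2 * (2 + real S)"
    using p_ge by (simp add: field_simps)
  then show "p \<le> 2 * (2 + real (Min (range (\<lambda>i. \<Sum>j\<in>UNIV - {i}. \<alpha> j)))) /
      (2 * (2 + real (Min (range (\<lambda>i. \<Sum>j\<in>UNIV - {i}. \<alpha> j)))) - real (CARD('n) - 1) * real m)"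
    using cond unfolding S_def[symmetric] by (simp add: pos_le_divide_eq mult.commute)
qed (rule p_ge)

end
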